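(* Let $A\in\mathbb{R}^{d\times d}$ be symmetric, $b\in\mathbb{R}^d$, $R>0$, and $f(x)=\frac12x^TAx+b^Tx$. Let $x_\star$ be a solution of $\min\{f(x):\|x\|\le R\}$ and $\lambda_{\mathsf{tr}}$ its optimal Lagrange multiplier. For each integer $t\ge1$ let $$x_t\in\operatorname*{argmin}\{f(x): x\in\mathcal{K}_t(A,b),\ \|x\|\le R\}.$$ Then for every $t\ge1$, $$f(x_t)-f(x_\star)\le 36\,[f(0)-f(x_\star)]\exp\left(-4t\sqrt{\frac{\lambda_{\min}+\lambda_{\mathsf{tr}}}{\lambda_{\max}+\lambda_{\mathsf{tr}}}}\right),$$ and $$f(x_t)-f(x_\star)\le\frac{(\lambda_{\max}-\lambda_{\min})\|x_\star\|^2}{(t-\frac12)^2}\left[4+\frac{\mathbb{I}_{\{\lambda_{\min}<0\}}}{8}\log^2\left(\frac{4\|b\|^2}{(b^{(1)})^2}\right)\right].$$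
   Context: $\|\cdot\|$ is the Euclidean norm. $\lambda_{\min},\lambda_{\max}$ are the smallest and largest eigenvalues of $A$, and $b^{(1)}=v_{\min}^Tb$, where $v_{\min}$ is a unit eigenvector of $A$ for $\lambda_{\min}$. The Krylov subspace is $\mathcal{K}_t(A,b)=\mathrm{span}\{b,Ab,\dots,A^{t-1}b\}$. The multiplier $\lambda_{\mathsf{tr}}$ is a number with $(A+\lambda_{\mathsf{tr}}I)x_\star+b=0$, $\lambda_{\mathsf{tr}}\ge\max\{-\lambda_{\min},0\}$ and $\lambda_{\mathsf{tr}}(R-\|x_\star\|)=0$ (such a number always exists at a global solution). $\mathbb{I}$ denotes an indicator ($0/1$ valued). Degenerate conventions: a ratio $0/0$ in the first bound is read as $0$; when $\lambda_{\min}<0$ and $b^{(1)}=0$ the second bound is vacuous (right-hand side $+\infty$), and when $\lambda_{\min}\ge0$ the logarithmic term is absent. *)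

theory Defs
  imports "HOL-Analysis.Analysis"
begin

definition eigenvalues :: "real^'d^'d \<Rightarrow> real set" where
  "eigenvalues A = {l. \<exists>v. v \<noteq> 0 \<and> A *v v = l *\<^sub>R v}"

text \<open>Used only for symmetric matrices, where the set of real eigenvalues is finite and nonempty
  and is the whole spectrum, so that \<^const>\<open>Min\<close> and \<^const>\<open>Max\<close> are meaningful.\<close>

definition lambda_min :: "real^'d^'d \<Rightarrow> real" where
  "lambda_min A = Min (eigenvalues A)"

definition lambda_max :: "real^'d^'d \<Rightarrow> real" where
  "lambda_max A = Max (eigenvalues A)"

definition quad_obj :: "real^'d^'d \<Rightarrow> real^'d \<Rightarrow> real^'d \<Rightarrow> real" where
  "quad_obj A b x = 1 / 2 * (x \<bullet> (A *v x)) + b \<bullet> x"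

text \<open>Matrix powers are written as iterates of the action of \<open>A\<close>, because multiplication, and hence
  \<open>A ^ i\<close>, is componentwise on the type of \<open>A\<close>.\<close>

definition krylov :: "real^'d^'d \<Rightarrow> real^'d \<Rightarrow> nat \<Rightarrow> (real^'d) set" where
  "krylov A b t = span ((\<lambda>i. ((\<lambda>v. A *v v) ^^ i) b) ` {..<t})"

end

theory Submission
  imports Defs
begin

text \<open>
  Write \<open>c\<close> for the multiplier. Every polynomial \<open>Q\<close> of degree at most \<open>t\<close> with \<open>Q(- c) = 1\<close> yields a
  point \<open>y\<close> of the Krylov space with \<open>xstar - y = Q(A) xstar\<close>, and on the sphere through \<open>xstar\<close> the
  gap of the objective is half of the quadratic form of \<open>A + c I\<close> at \<open>y - xstar\<close>.

  A normalized Chebyshev polynomial followed by a rescaling of \<open>y\<close> to that sphere gives the linear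
  rate. The constant 36 makes the bound trivial as soon as the residual is not below \<open>1 / 3\<close>.

  For the second rate \<open>Q\<close> is a normalized Fejer kernel. As it takes values in \<open>[0, 1]\<close>, the point \<open>y\<close>
  is feasible, and the gap of the convexified objective (spectrum shifted by \<open>min (lambda_min A) 0\<close>)
  is at most \<open>4 * (lambda_max A - lambda_min A) * (norm xstar)^2 / (t + 1)^2\<close>. If \<open>lambda_min A\<close> is
  negative, \<open>xstar\<close> lies on the boundary and \<open>y\<close> is moved to the boundary along an approximate minimal
  eigenvector from the Krylov space, oriented as a descent direction. The price is the
  Kuczynski-Wozniakowski bound for the Lanczos method, which is the logarithmic term.
\<close>

section \<open>The spectral theorem for symmetric real matrices\<close>

lemma symmetric_inner_mul_vec:
  fixes A :: "real^'d^'d"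
  assumes "transpose A = A"
  shows "(A *v x) \<bullet> y = x \<bullet> (A *v y)"
  by (metis assms dot_lmul_matrix transpose_matrix_vector)

text \<open>A maximizer \<open>v\<close> of the Rayleigh quotient on the unit sphere of
  \<open>S\<close> is an eigenvector: its residual \<open>w\<close> lies in \<open>S\<close> and is
  orthogonal to \<open>v\<close>, so moving from \<open>v\<close> along \<open>w\<close> would raise
  the quotient to first order unless \<open>w = 0\<close>.\<close>

lemma symmetric_eigenvector_exists:
  fixes A :: "real^'d^'d"
  assumes sym: "transpose A = A" and S: "subspace S"
    and inv: "\<And>x. x \<in> S \<Longrightarrow> A *v x \<in> S" and ne: "S \<noteq> {0}"
  obtains v where "v \<in> S" "norm v = 1" "A *v v = (v \<bullet> (A *v v)) *\<^sub>R v"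
proof -
  have "closed S" by (rule closed_subspace[OF S])
  then have comp: "compact (S \<inter> sphere 0 1)"
    by (simp add: closed_Int_compact)
  obtain s where s: "s \<in> S" "s \<noteq> 0" using ne subspace_0[OF S] by auto
  have "s /\<^sub>R norm s \<in> S \<inter> sphere 0 1"
    using s S by (simp add: subspace_scale)
  then have ne': "S \<inter> sphere 0 1 \<noteq> {}" by blast
  have "continuous_on (S \<inter> sphere 0 1) (\<lambda>x. x \<bullet> (A *v x))"
    by (intro continuous_intros linear_continuous_on matrix_vector_mul_bounded_linear)
  from continuous_attains_sup[OF comp ne' this] obtain v where
    v: "v \<in> S" "norm v = 1" and
    vmax: "\<And>y. y \<in> S \<Longrightarrow> norm y = 1 \<Longrightarrow> y \<bullet> (A *v y) \<le> v \<bullet> (A *v v)"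
    by auto
  define m where "m = v \<bullet> (A *v v)"
  have hom: "y \<bullet> (A *v y) \<le> m * (norm y)\<^sup>2" if "y \<in> S" for y
  proof (cases "y = 0")
    case False
    have "(y /\<^sub>R norm y) \<bullet> (A *v (y /\<^sub>R norm y)) \<le> m"
      unfolding m_def by (rule vmax) (use that False S in \<open>auto simp: subspace_scale\<close>)
    then show ?thesis using False
      by (simp add: matrix_vector_mult_scaleR field_simps power2_eq_square)
  qed auto
  define w where "w = A *v v - m *\<^sub>R v"
  have wS: "w \<in> S" unfolding w_def using v S inv by (simp add: subspace_diff subspace_scale)
  have vv: "v \<bullet> v = 1" using v by (simp add: dot_square_norm)
  have wv: "v \<bullet> w = 0" by (simp add: w_def m_def inner_diff_right vv)
  have wAv: "w \<bullet> (A *v v) = w \<bullet> w"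
    using wv by (simp add: w_def inner_diff_right inner_diff_left inner_commute)
  have quad: "2 * t * (w \<bullet> w) + t\<^sup>2 * (w \<bullet> (A *v w)) \<le> m * t\<^sup>2 * (w \<bullet> w)" for t
  proof -
    have "v + t *\<^sub>R w \<in> S" using v wS S by (simp add: subspace_add subspace_scale)
    from hom[OF this] have "(v + t *\<^sub>R w) \<bullet> (A *v (v + t *\<^sub>R w)) \<le> m * (norm (v + t *\<^sub>R w))\<^sup>2" .
    moreover have "(v + t *\<^sub>R w) \<bullet> (A *v (v + t *\<^sub>R w)) = m + 2 * t * (w \<bullet> w) + t\<^sup>2 * (w \<bullet> (A *v w))"
      using wAv symmetric_inner_mul_vec[OF sym, of v w]
      by (simp add: matrix_vector_mult_scaleR matrix_vector_right_distrib inner_add_left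
          inner_add_right m_def power2_eq_square inner_commute algebra_simps)
    moreover have "(norm (v + t *\<^sub>R w))\<^sup>2 = 1 + t\<^sup>2 * (w \<bullet> w)"
      unfolding power2_norm_eq_inner using wv vv
      by (simp add: inner_add_left inner_add_right inner_commute power2_eq_square)
    ultimately show ?thesis by (simp add: algebra_simps)
  qed
  have "w \<bullet> w = 0"
  proof (rule ccontr)
    assume "w \<bullet> w \<noteq> 0"
    then have p: "w \<bullet> w > 0" by simp
    \<comment> \<open>This \<open>c\<close> is positive and dominates the second-order coefficient,
      so at \<open>t = (w \<bullet> w) / c\<close> the quadratic term is at most half of the linear
      term \<open>2 * t * (w \<bullet> w)\<close>.\<close>
    define c where "c = \<bar>m * (w \<bullet> w) - w \<bullet> (A *v w)\<bar> + w \<bullet> w"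
    have c: "c > 0" "m * (w \<bullet> w) - w \<bullet> (A *v w) \<le> c"
      unfolding c_def using p by linarith+
    define t where "t = (w \<bullet> w) / c"
    have t: "t > 0" using p c by (simp add: t_def)
    have "2 * t * (w \<bullet> w) \<le> t\<^sup>2 * (m * (w \<bullet> w) - w \<bullet> (A *v w))"
      using quad[of t] by (simp add: algebra_simps)
    also have "\<dots> \<le> t\<^sup>2 * c" using c by (intro mult_left_mono) auto
    also have "\<dots> = t * (w \<bullet> w)" using c by (simp add: t_def power2_eq_square)
    finally show False using t p by simp
  qed
  then have "A *v v = m *\<^sub>R v" by (simp add: w_def)
  with v show ?thesis using that unfolding m_def by blast
qed

text \<open>Induction on the dimension: split off one eigenvector; by symmetry its orthogonal
  complement in \<open>S\<close> is again invariant. Working inside invariant subspaces keeps the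
  matrix fixed during the induction.\<close>

lemma spectral_theorem_subspace:
  fixes A :: "real^'d^'d"
  assumes sym: "transpose A = A" and S: "subspace S"
    and inv: "\<And>x. x \<in> S \<Longrightarrow> A *v x \<in> S"
  shows "\<exists>B. finite B \<and> pairwise orthogonal B \<and> span B = S \<and>
    (\<forall>v\<in>B. norm v = 1 \<and> A *v v = (v \<bullet> (A *v v)) *\<^sub>R v)"
  using S inv
proof (induction "dim S" arbitrary: S rule: less_induct)
  case less
  show ?case
  proof (cases "S = {0}")
    case True
    then show ?thesis by (intro exI[of _ "{}"]) auto
  next
    case False
    obtain v where v: "v \<in> S" "norm v = 1" "A *v v = (v \<bullet> (A *v v)) *\<^sub>R v"
      using symmetric_eigenvector_exists[OF sym less.prems False] by metis
    define T where "T = {x \<in> S. v \<bullet> x = 0}"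
    have vv: "v \<bullet> v = 1" using v by (simp add: dot_square_norm)
    have T: "subspace T" using less.prems(1) unfolding T_def
      by (auto simp: subspace_def inner_add_right)
    have Tinv: "A *v x \<in> T" if "x \<in> T" for x
    proof -
      have "v \<bullet> (A *v x) = (v \<bullet> (A *v v)) * (v \<bullet> x)"
        by (metis symmetric_inner_mul_vec[OF sym] v(3) inner_scaleR_left)
      then show ?thesis using that less.prems(2) by (simp add: T_def)
    qed
    have "v \<notin> T" "T \<subseteq> S" using vv by (auto simp: T_def)
    then have "T \<subset> S" using v by blast
    then have "dim T < dim S"
      using T less.prems(1) by (metis dim_psubset span_eq_iff)
    from less.hyps[OF this T Tinv] obtain B where
      B: "finite B" "pairwise orthogonal B" "span B = T"
      "\<forall>v\<in>B. norm v = 1 \<and> A *v v = (v \<bullet> (A *v v)) *\<^sub>R v" by blast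
    have orth: "v \<bullet> y = 0" if "y \<in> B" for y
      using that B(3) span_superset[of B] by (auto simp: T_def)
    have "span (insert v B) = S"
    proof
      show "span (insert v B) \<subseteq> S"
        using v B(3) span_superset[of B] less.prems(1)
        by (intro span_minimal) (auto simp: T_def)
      show "S \<subseteq> span (insert v B)"
      proof
        fix x assume x: "x \<in> S"
        have "x - (v \<bullet> x) *\<^sub>R v \<in> T"
          using x v vv less.prems(1)
          by (simp add: T_def subspace_diff subspace_scale inner_diff_right)
        then show "x \<in> span (insert v B)"
          using B(3) by (auto simp: span_insert)
      qed
    qed
    moreover have "pairwise orthogonal (insert v B)"
      using B(2) orth by (auto simp: pairwise_insert orthogonal_def inner_commute)
    ultimately show ?thesis using B v
      by (intro exI[of _ "insert v B"]) auto
  qed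
qed

text \<open>The given unit eigenvector becomes a basis member. This matters because the logarithmic
  term refers to the component of \<open>b\<close> along a prescribed minimal eigenvector, which
  thus is a coordinate.\<close>

lemma spectral_theorem_extending:
  fixes A :: "real^'d^'d"
  assumes sym: "transpose A = A" and u: "norm u = 1" "A *v u = l *\<^sub>R u"
  obtains B where "u \<in> B" "finite B" "pairwise orthogonal B" "span B = UNIV"
    "\<And>v. v \<in> B \<Longrightarrow> norm v = 1" "\<And>v. v \<in> B \<Longrightarrow> A *v v = (v \<bullet> (A *v v)) *\<^sub>R v"
proof -
  define T where "T = {x. u \<bullet> x = 0}"
  have uu: "u \<bullet> u = 1" using u by (simp add: dot_square_norm)
  have T: "subspace T" unfolding T_def by (rule subspace_hyperplane)
  have Tinv: "A *v x \<in> T" if "x \<in> T" for x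
  proof -
    have "u \<bullet> (A *v x) = l * (u \<bullet> x)"
      by (metis symmetric_inner_mul_vec[OF sym] u(2) inner_scaleR_left)
    then show ?thesis using that by (simp add: T_def)
  qed
  from spectral_theorem_subspace[OF sym T Tinv] obtain B where
    B: "finite B" "pairwise orthogonal B" "span B = T"
    "\<forall>v\<in>B. norm v = 1 \<and> A *v v = (v \<bullet> (A *v v)) *\<^sub>R v" by blast
  have orth: "u \<bullet> y = 0" if "y \<in> B" for y
    using that B(3) span_superset[of B] by (auto simp: T_def)
  have "x \<in> span (insert u B)" for x
  proof -
    have "x - (u \<bullet> x) *\<^sub>R u \<in> T"
      using uu by (simp add: T_def inner_diff_right)
    then show ?thesis using B(3) by (auto simp: span_insert)
  qed
  moreover have "pairwise orthogonal (insert u B)"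
    using B(2) orth by (auto simp: pairwise_insert orthogonal_def inner_commute)
  ultimately show ?thesis using B u uu
    by (intro that[of "insert u B"]) auto
qed

section \<open>Extremal polynomials\<close>

text \<open>The Fejer kernel (sin (n theta) / sin theta)^2 as a polynomial in w = sin^2 theta. The
  recurrence comes from adding sin^2 (a + theta) and sin^2 (a - theta).\<close>

fun fejer_poly :: "nat \<Rightarrow> real poly" where
  "fejer_poly 0 = 0"
| "fejer_poly (Suc 0) = 1"
| "fejer_poly (Suc (Suc n)) = [:2, -4:] * fejer_poly (Suc n) - fejer_poly n + [:2:]"

text \<open>The quotient sin ((2n + 1) theta) / sin theta in the variable w = sin^2 theta, that is,
  the Chebyshev polynomial of the second kind of degree 2n at cos theta.\<close>

fun odd_sine_poly :: "nat \<Rightarrow> real poly" where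
  "odd_sine_poly 0 = 1"
| "odd_sine_poly (Suc 0) = [:3, -4:]"
| "odd_sine_poly (Suc (Suc n)) = [:2, -4:] * odd_sine_poly (Suc n) - odd_sine_poly n"

lemma degree_fejer_poly: "degree (fejer_poly k) \<le> k - 1"
proof (induction k rule: fejer_poly.induct)
  case (3 n)
  have "degree ([:2, -4:] * fejer_poly (Suc n)) \<le> Suc n"
    using degree_mult_le[of "[:2, -4:]" "fejer_poly (Suc n)"] 3 by simp
  then show ?case using 3 by (auto intro!: degree_add_le degree_diff_le)
qed auto

lemma degree_odd_sine_poly: "degree (odd_sine_poly k) \<le> k"
proof (induction k rule: odd_sine_poly.induct)
  case (3 n)
  have "degree ([:2, -4:] * odd_sine_poly (Suc n)) \<le> Suc (Suc n)"
    using degree_mult_le[of "[:2, -4:]" "odd_sine_poly (Suc n)"] 3 by simp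
  then show ?case using 3 by (auto intro!: degree_diff_le)
qed auto

lemma fejer_poly_sin:
  "(sin \<theta>)\<^sup>2 * poly (fejer_poly n) ((sin \<theta>)\<^sup>2) = (sin (real n * \<theta>))\<^sup>2"
proof (induction n rule: fejer_poly.induct)
  case (3 n)
  define a s where "a = real (Suc n) * \<theta>" and "s = (sin \<theta>)\<^sup>2"
  have c: "(cos \<theta>)\<^sup>2 = 1 - s" "(cos a)\<^sup>2 = 1 - (sin a)\<^sup>2" by (simp_all add: s_def cos_squared_eq)
  have "(sin (a + \<theta>))\<^sup>2 + (sin (a - \<theta>))\<^sup>2 = 2 * ((sin a)\<^sup>2 * (cos \<theta>)\<^sup>2 + (cos a)\<^sup>2 * s)"
    by (simp add: sin_add sin_diff s_def power2_eq_square algebra_simps)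
  then have "(sin (a + \<theta>))\<^sup>2 = (2 - 4 * s) * (sin a)\<^sup>2 - (sin (a - \<theta>))\<^sup>2 + 2 * s"
    by (simp add: c algebra_simps)
  moreover have "a + \<theta> = real (Suc (Suc n)) * \<theta>" "a - \<theta> = real n * \<theta>"
    by (simp_all add: a_def algebra_simps)
  moreover have "s * poly (fejer_poly (Suc (Suc n))) s
      = (2 - 4 * s) * (s * poly (fejer_poly (Suc n)) s) - s * poly (fejer_poly n) s + 2 * s"
    by (simp add: algebra_simps)
  ultimately show ?case using 3 by (simp add: s_def a_def)
qed auto

text \<open>The counterpart of \<open>fejer_poly_sin\<close> under theta = i u. It reaches the
  arguments to the left of [0, 1], where the normalization takes place.\<close>

lemma fejer_poly_sinh:
  "(sinh u)\<^sup>2 * poly (fejer_poly n) (- (sinh u)\<^sup>2) = (sinh (real n * u))\<^sup>2"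
proof (induction n rule: fejer_poly.induct)
  case (3 n)
  define a s where "a = real (Suc n) * u" and "s = (sinh u)\<^sup>2"
  have c: "(cosh u)\<^sup>2 = 1 + s" "(cosh a)\<^sup>2 = 1 + (sinh a)\<^sup>2" by (simp_all add: s_def cosh_square_eq)
  have "(sinh (a + u))\<^sup>2 + (sinh (a - u))\<^sup>2 = 2 * ((sinh a)\<^sup>2 * (cosh u)\<^sup>2 + (cosh a)\<^sup>2 * s)"
    by (simp add: sinh_add sinh_diff s_def power2_eq_square algebra_simps)
  then have "(sinh (a + u))\<^sup>2 = (2 + 4 * s) * (sinh a)\<^sup>2 - (sinh (a - u))\<^sup>2 + 2 * s"
    by (simp add: c algebra_simps)
  moreover have "a + u = real (Suc (Suc n)) * u" "a - u = real n * u"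
    by (simp_all add: a_def algebra_simps)
  moreover have "s * poly (fejer_poly (Suc (Suc n))) (- s)
      = (2 + 4 * s) * (s * poly (fejer_poly (Suc n)) (- s)) - s * poly (fejer_poly n) (- s) + 2 * s"
    by (simp add: algebra_simps)
  ultimately show ?case using 3 by (simp add: s_def a_def)
qed auto

lemma odd_sine_poly_sin:
  "sin \<theta> * poly (odd_sine_poly n) ((sin \<theta>)\<^sup>2) = sin ((2 * real n + 1) * \<theta>)"
proof (induction n rule: odd_sine_poly.induct)
  case 2
  have "sin (2 * \<theta> + \<theta>) = 3 * sin \<theta> - 4 * sin \<theta> * (sin \<theta>)\<^sup>2"
    unfolding sin_add sin_double cos_double
    using cos_squared_eq[of \<theta>] by algebra
  then show ?case by (simp add: algebra_simps)
next
  case (3 n)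
  define a where "a = (2 * real n + 3) * \<theta>"
  have "sin (a + 2 * \<theta>) + sin (a - 2 * \<theta>) = 2 * sin a * cos (2 * \<theta>)"
    by (simp only: sin_add sin_diff)
  also have "cos (2 * \<theta>) = 1 - 2 * (sin \<theta>)\<^sup>2" by (simp add: cos_double_sin)
  finally have "sin (a + 2 * \<theta>) = (2 - 4 * (sin \<theta>)\<^sup>2) * sin a - sin (a - 2 * \<theta>)"
    by (simp add: algebra_simps)
  moreover have "a + 2 * \<theta> = (2 * real (Suc (Suc n)) + 1) * \<theta>"
    "a - 2 * \<theta> = (2 * real n + 1) * \<theta>" "a = (2 * real (Suc n) + 1) * \<theta>"
    by (simp_all add: a_def algebra_simps)
  moreover have "sin \<theta> * poly (odd_sine_poly (Suc (Suc n))) ((sin \<theta>)\<^sup>2)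
      = (2 - 4 * (sin \<theta>)\<^sup>2) * (sin \<theta> * poly (odd_sine_poly (Suc n)) ((sin \<theta>)\<^sup>2))
        - sin \<theta> * poly (odd_sine_poly n) ((sin \<theta>)\<^sup>2)"
    by (simp add: algebra_simps)
  ultimately show ?case using 3 by simp
qed auto

lemma odd_sine_poly_sinh:
  "sinh u * poly (odd_sine_poly n) (- (sinh u)\<^sup>2) = sinh ((2 * real n + 1) * (u::real))"
proof (induction n rule: odd_sine_poly.induct)
  case 2
  have "sinh (2 * u + u) = 3 * sinh u + 4 * sinh u * (sinh u)\<^sup>2"
    unfolding sinh_add sinh_double cosh_double
    using cosh_square_eq[of u] by algebra
  then show ?case by (simp add: algebra_simps)
next
  case (3 n)
  define a where "a = (2 * real n + 3) * u"
  have "sinh (a + 2 * u) + sinh (a - 2 * u) = 2 * sinh a * cosh (2 * u)"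
    by (simp only: sinh_add sinh_diff)
  also have "cosh (2 * u) = 1 + 2 * (sinh u)\<^sup>2" by (simp add: cosh_double cosh_square_eq)
  finally have "sinh (a + 2 * u) = (2 + 4 * (sinh u)\<^sup>2) * sinh a - sinh (a - 2 * u)"
    by (simp add: algebra_simps)
  moreover have "a + 2 * u = (2 * real (Suc (Suc n)) + 1) * u"
    "a - 2 * u = (2 * real n + 1) * u" "a = (2 * real (Suc n) + 1) * u"
    by (simp_all add: a_def algebra_simps)
  moreover have "sinh u * poly (odd_sine_poly (Suc (Suc n))) (- (sinh u)\<^sup>2)
      = (2 + 4 * (sinh u)\<^sup>2) * (sinh u * poly (odd_sine_poly (Suc n)) (- (sinh u)\<^sup>2))
        - sinh u * poly (odd_sine_poly n) (- (sinh u)\<^sup>2)"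
    by (simp add: algebra_simps)
  ultimately show ?case using 3 by simp
qed auto

section \<open>Size of the polynomials on [0, 1] and growth to its left\<close>

lemma unit_interval_sin_square:
  fixes w :: real
  assumes "0 \<le> w" "w \<le> 1"
  obtains \<theta> where "w = (sin \<theta>)\<^sup>2"
proof
  have "- 1 \<le> sqrt w" using real_sqrt_ge_zero[OF assms(1)] by linarith
  then show "w = (sin (arcsin (sqrt w)))\<^sup>2" using assms by simp
qed

lemma fejer_poly_0: "poly (fejer_poly n) 0 = (real n)\<^sup>2"
  by (induction n rule: fejer_poly.induct) (auto simp: power2_eq_square algebra_simps)

lemma abs_sin_multiple_le: "\<bar>sin (real n * \<theta>)\<bar> \<le> real n * \<bar>sin \<theta>\<bar>"
proof (induction n)
  case (Suc n)
  have "\<bar>sin (real n * \<theta> + \<theta>)\<bar> \<le> \<bar>sin (real n * \<theta>)\<bar> * \<bar>cos \<theta>\<bar> + \<bar>cos (real n * \<theta>)\<bar> * \<bar>sin \<theta>\<bar>"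
    unfolding sin_add by (metis abs_mult abs_triangle_ineq)
  also have "\<dots> \<le> \<bar>sin (real n * \<theta>)\<bar> * 1 + 1 * \<bar>sin \<theta>\<bar>"
    by (intro add_mono mult_mono) auto
  finally show ?case using Suc by (simp add: algebra_simps)
qed auto

lemma fejer_poly_bounds:
  assumes "0 \<le> w" "w \<le> 1"
  shows "0 \<le> poly (fejer_poly n) w" "poly (fejer_poly n) w \<le> (real n)\<^sup>2"
    "w * poly (fejer_poly n) w \<le> 1"
proof -
  obtain \<theta> where \<theta>: "w = (sin \<theta>)\<^sup>2" using unit_interval_sin_square[OF assms] .
  have eq: "w * poly (fejer_poly n) w = (sin (real n * \<theta>))\<^sup>2" unfolding \<theta> by (rule fejer_poly_sin)
  then show "w * poly (fejer_poly n) w \<le> 1" by (simp add: abs_square_le_1)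
  have "0 \<le> poly (fejer_poly n) w \<and> poly (fejer_poly n) w \<le> (real n)\<^sup>2"
  \<comment> \<open>The identity carries a factor \<open>w\<close> and is empty at
    \<open>w = 0\<close>, where the value has to be known explicitly.\<close>
  proof (cases "w = 0")
    case False
    then have w: "w > 0" using assms by simp
    have "(sin (real n * \<theta>))\<^sup>2 \<le> (real n * \<bar>sin \<theta>\<bar>)\<^sup>2"
      by (metis abs_ge_zero abs_sin_multiple_le power2_abs power_mono)
    then have "w * poly (fejer_poly n) w \<le> w * (real n)\<^sup>2"
      unfolding eq by (simp add: \<theta> power_mult_distrib mult.commute)
    moreover have "0 \<le> w * poly (fejer_poly n) w" unfolding eq by simp
    ultimately show ?thesis using w by (simp add: zero_le_mult_iff)
  qed (auto simp: fejer_poly_0)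
  then show "0 \<le> poly (fejer_poly n) w" "poly (fejer_poly n) w \<le> (real n)\<^sup>2" by auto
qed

text \<open>The bound is the first-order Taylor polynomial of the kernel at 0.\<close>

lemma fejer_poly_neg_ge:
  assumes x: "x \<ge> 0"
  shows "poly (fejer_poly n) (- x) \<ge> (real n)\<^sup>2 + (real n)\<^sup>2 * ((real n)\<^sup>2 - 1) / 3 * x"
proof -
  define F P where "F n = poly (fejer_poly n) (- x)"
    and "P n = (real n)\<^sup>2 + (real n)\<^sup>2 * ((real n)\<^sup>2 - 1) / 3 * x" for n
  have P: "P n \<ge> (real n)\<^sup>2" for n
  proof (cases n)
    case (Suc m)
    then have "(real n)\<^sup>2 \<ge> 1" by simp
    then show ?thesis using x by (simp add: P_def)
  qed (simp add: P_def)
  \<comment> \<open>The recurrence is of second order, so the induction also compares increments.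
    \<open>P\<close> satisfies it with \<open>x * F (Suc n)\<close> weakened to
    \<open>x * (real (Suc n))\<^sup>2\<close>.\<close>
  have "F n \<ge> P n \<and> F (Suc n) - F n \<ge> P (Suc n) - P n"
  proof (induction n)
    case (Suc n)
    have "x * (real (Suc n))\<^sup>2 \<le> x * F (Suc n)"
      using Suc P[of "Suc n"] x by (intro mult_left_mono) auto
    moreover have "F (Suc (Suc n)) - F (Suc n) = F (Suc n) - F n + 4 * (x * F (Suc n)) + 2"
      by (simp add: F_def algebra_simps)
    moreover have "P (Suc (Suc n)) - P (Suc n) = P (Suc n) - P n + 4 * (x * (real (Suc n))\<^sup>2) + 2"
      by (simp add: P_def power2_eq_square field_simps)
    ultimately show ?case using Suc by linarith
  qed (simp add: F_def P_def)
  then show ?thesis by (simp add: F_def P_def)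
qed

lemma odd_sine_poly_bound:
  assumes "0 \<le> w" "w \<le> 1"
  shows "w * (poly (odd_sine_poly n) w)\<^sup>2 \<le> 1"
proof -
  obtain \<theta> where \<theta>: "w = (sin \<theta>)\<^sup>2" using unit_interval_sin_square[OF assms] .
  have "w * (poly (odd_sine_poly n) w)\<^sup>2 = (sin ((2 * real n + 1) * \<theta>))\<^sup>2"
    unfolding odd_sine_poly_sin[symmetric] by (simp add: \<theta> power_mult_distrib)
  then show ?thesis by (simp add: abs_square_le_1)
qed

section \<open>Polynomials on the spectral interval, with the hyperbolic facts they need\<close>

lemma tanh_real_le:
  fixes x :: real
  assumes "x \<ge> 0"
  shows "tanh x \<le> x"
proof -
  have "0 - tanh 0 \<le> x - tanh x"
  proof (rule DERIV_nonneg_imp_nondecreasing[OF assms])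
    fix y :: real
    show "\<exists>D. ((\<lambda>x. x - tanh x) has_real_derivative D) (at y) \<and> 0 \<le> D"
      by (rule exI[of _ "(tanh y)\<^sup>2"]) (auto intro!: derivative_eq_intros)
  qed
  then show ?thesis by simp
qed

lemma sinh_real_surj:
  fixes y :: real
  obtains u where "sinh u = y"
proof
  define z where "z = y + sqrt (y\<^sup>2 + 1)"
  have z: "z > 0" unfolding z_def by (rule arsinh_real_aux)
  have "(y + sqrt (y\<^sup>2 + 1)) * (sqrt (y\<^sup>2 + 1) - y) = (sqrt (y\<^sup>2 + 1))\<^sup>2 - y\<^sup>2"
    by (simp only: power2_eq_square algebra_simps)
  also have "\<dots> = 1" by simp
  finally have "inverse z = sqrt (y\<^sup>2 + 1) - y"
    unfolding z_def by (rule inverse_unique)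
  then show "sinh (ln z) = y" using z by (simp add: sinh_ln_real z_def)
qed

text \<open>The residual polynomial is the Chebyshev polynomial of degree \<open>t\<close>, in the form
  \<open>cos (2 * t * \<theta>) = 1 - 2 * (sin (t * \<theta>))\<^sup>2\<close>, transported to \<open>[l, h]\<close> and normalized at \<open>- c\<close>.\<close>

lemma geometric_residual_poly:
  fixes l h c :: real
  assumes lh: "l \<le> h" and pos: "l + c > 0" and t: "t \<ge> 1"
  obtains Q where "degree Q \<le> t" "poly Q (- c) = 1"
    "\<And>m. l \<le> m \<Longrightarrow> m \<le> h \<Longrightarrow> \<bar>poly Q m\<bar> \<le> 2 * exp (- 2 * real t * sqrt ((l + c) / (h + c)))"
proof (cases "l = h")
  case True
  show ?thesis
  proof
    \<comment> \<open>With a one-point interval, the linear polynomial with root \<open>l\<close>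
      leaves no residual at all.\<close>
    show "degree [:l / (l + c), - 1 / (l + c):] \<le> t" using t by simp
    show "poly [:l / (l + c), - 1 / (l + c):] (- c) = 1"
      using pos by (simp add: add_divide_distrib[symmetric])
  qed (use True in auto)
next
  case False
  define L where "L = h - l"
  have L: "L > 0" using lh False by (simp add: L_def)
  define T where "T = [:1:] - [:0, 2:] * fejer_poly t"
  define a where "a = [:- l / L, 1 / L:]"
  have pa: "poly a m = (m - l) / L" for m by (simp add: a_def diff_divide_distrib)
  \<comment> \<open>The affine map \<open>a\<close> sends [l, h] to [0, 1] and \<open>- c\<close> to
    \<open>- (sinh u)\<^sup>2\<close>, so the normalizing value is a hyperbolic cosine.\<close>
  obtain u where u: "sinh u = sqrt ((l + c) / L)" using sinh_real_surj by blast
  have u0: "u \<ge> 0" using u pos L by (metis sinh_real_nonneg_iff real_sqrt_ge_zero less_imp_le divide_pos_pos)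
  have su: "(sinh u)\<^sup>2 = (l + c) / L" using pos L by (simp add: u)
  define D where "D = poly T (- ((l + c) / L))"
  have "D = 1 + 2 * ((sinh u)\<^sup>2 * poly (fejer_poly t) (- (sinh u)\<^sup>2))"
    by (simp add: D_def T_def su)
  also have "\<dots> = cosh (2 * (real t * u))" by (simp add: fejer_poly_sinh cosh_double cosh_square_eq)
  finally have D: "D = cosh (2 * (real t * u))" .
  have cu: "cosh u = sqrt ((h + c) / L)"
  proof (rule real_sqrt_unique[symmetric])
    show "(cosh u)\<^sup>2 = (h + c) / L" using L by (simp add: cosh_square_eq su L_def field_simps)
  qed simp
  \<comment> \<open>The square root in the rate is \<open>tanh u\<close>; the inequality
    \<open>tanh u \<le> u\<close> passes it into the exponent of cosh.\<close>
  have "tanh u = sqrt ((l + c) / (h + c))"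
    using L by (simp add: tanh_def u cu real_sqrt_divide[symmetric])
  then have "sqrt ((l + c) / (h + c)) \<le> u" using tanh_real_le[OF u0] by simp
  then have "2 * real t * sqrt ((l + c) / (h + c)) \<le> 2 * (real t * u)"
    by (simp add: mult_left_mono)
  then have "exp (2 * real t * sqrt ((l + c) / (h + c))) \<le> exp (2 * (real t * u))" by simp
  also have "\<dots> \<le> 2 * D" by (simp add: D cosh_field_def)
  finally have Dge: "exp (2 * real t * sqrt ((l + c) / (h + c))) \<le> 2 * D" .
  have D0: "D > 0" by (simp add: D)
  have inv: "1 / D \<le> 2 * exp (- 2 * real t * sqrt ((l + c) / (h + c)))"
    using Dge D0 by (simp add: exp_minus field_simps)
  show ?thesis
  proof
    have "degree ([:0, 2:] * fejer_poly t) \<le> t"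
      using degree_mult_le[of "[:0, 2:]" "fejer_poly t"] degree_fejer_poly[of t] t by simp
    then have "degree T \<le> t" unfolding T_def by (auto intro!: degree_diff_le)
    then show "degree (smult (1 / D) (pcompose T a)) \<le> t"
      using L by (simp add: a_def degree_pcompose)
    have "poly a (- c) = - ((l + c) / L)" by (simp add: pa diff_divide_distrib add_divide_distrib)
    then show "poly (smult (1 / D) (pcompose T a)) (- c) = 1"
      using D0 by (simp add: poly_pcompose D_def)
    fix m assume m: "l \<le> m" "m \<le> h"
    have "0 \<le> poly a m" "poly a m \<le> 1" using m L by (auto simp: pa L_def)
    from fejer_poly_bounds(1,3)[OF this, of t] this(1)
    have "0 \<le> poly a m * poly (fejer_poly t) (poly a m)" "poly a m * poly (fejer_poly t) (poly a m) \<le> 1"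
      by simp_all
    moreover have "poly T (poly a m) = 1 - 2 * (poly a m * poly (fejer_poly t) (poly a m))"
      by (simp add: T_def)
    ultimately have "\<bar>poly T (poly a m)\<bar> \<le> 1" by linarith
    then have "\<bar>poly T (poly a m)\<bar> / D \<le> 1 / D" using D0 by (simp add: divide_right_mono)
    then have "\<bar>poly T (poly a m)\<bar> / D \<le> 2 * exp (- 2 * real t * sqrt ((l + c) / (h + c)))"
      using inv by (rule order_trans)
    then show "\<bar>poly (smult (1 / D) (pcompose T a)) m\<bar> \<le> 2 * exp (- 2 * real t * sqrt ((l + c) / (h + c)))"
      using D0 by (simp add: poly_pcompose abs_mult)
  qed
qed

text \<open>The residual polynomial is the Fejer kernel \<open>(sin (k * \<theta>) / sin \<theta>)\<^sup>2\<close> with \<open>k = t + 1\<close>,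
  transported to \<open>[l, h]\<close> and normalized at \<open>- c\<close>.\<close>

lemma sublinear_residual_poly:
  fixes l h c :: real
  assumes lh: "l \<le> h" and nonneg: "l + c \<ge> 0" and t: "t \<ge> 1"
  obtains Q where "degree Q \<le> t" "poly Q (- c) = 1"
    "\<And>m. l \<le> m \<Longrightarrow> m \<le> h \<Longrightarrow> 0 \<le> poly Q m" "\<And>m. l \<le> m \<Longrightarrow> m \<le> h \<Longrightarrow> poly Q m \<le> 1"
    "\<And>m. l \<le> m \<Longrightarrow> m \<le> h \<Longrightarrow> (m + c) * poly Q m \<le> 4 * (h - l) / (real t + 1)\<^sup>2"
proof -
  \<comment> \<open>If the interval is the single point \<open>- c\<close>, normalization forbids a
    root there, but \<open>m + c\<close> itself vanishes and \<open>Q = 1\<close> works.\<close>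
  consider "l = h" "l + c = 0" | "l = h" "l + c > 0" | "l < h" using lh nonneg by linarith
  then show ?thesis
  proof cases
    case 1
    show ?thesis by (rule that[of 1]) (use 1 in auto)
  next
    case 2
    show ?thesis
    proof
      show "degree [:l / (l + c), - 1 / (l + c):] \<le> t" using t by simp
      show "poly [:l / (l + c), - 1 / (l + c):] (- c) = 1"
        using 2 by (simp add: add_divide_distrib[symmetric])
    qed (use 2 in auto)
  next
    case 3
    define L where "L = h - l"
    have L: "L > 0" using 3 by (simp add: L_def)
    define k where "k = (real t + 1)\<^sup>2"
    have k: "k \<ge> 4" using t power_mono[of 2 "real t + 1" 2] by (simp add: k_def)
    define F where "F = fejer_poly (t + 1)"
    define a where "a = [:- l / L, 1 / L:]"
    have pa: "poly a m = (m - l) / L" for m by (simp add: a_def diff_divide_distrib)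
    define x where "x = (l + c) / L"
    have x: "x \<ge> 0" using nonneg L by (simp add: x_def)
    define D where "D = poly F (- x)"
    \<comment> \<open>The inequality (k - 1) / 3 >= k / 4 is exactly k >= 4, which is supplied by t
      >= 1.\<close>
    have "k * (1 + k * x / 4) \<le> k + k * (k - 1) / 3 * x"
      using k x mult_mono[of 4 k x x] by (simp add: field_simps)
    also have "\<dots> \<le> D" using fejer_poly_neg_ge[OF x, of "t + 1"]
      by (simp add: D_def F_def k_def add.commute)
    finally have Dge: "k * (1 + k * x / 4) \<le> D" .
    have kx: "0 \<le> k * x" using k x by simp
    have "k * 1 \<le> k * (1 + k * x / 4)" using k kx by (intro mult_left_mono) auto
    then have Dk: "k \<le> D" using Dge by linarith
    then have D0: "D > 0" using k by linarith
    show ?thesis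
    proof
      have "degree F \<le> t" unfolding F_def using degree_fejer_poly[of "t + 1"] by simp
      then show "degree (smult (1 / D) (pcompose F a)) \<le> t"
        using L by (simp add: a_def degree_pcompose)
      have "poly a (- c) = - x" by (simp add: pa x_def diff_divide_distrib add_divide_distrib)
      then show "poly (smult (1 / D) (pcompose F a)) (- c) = 1"
        using D0 by (simp add: poly_pcompose D_def)
      fix m assume m: "l \<le> m" "m \<le> h"
      define w where "w = (m - l) / L"
      have w: "0 \<le> w" "w \<le> 1" using m L by (auto simp: w_def L_def)
      have kk: "(real (t + 1))\<^sup>2 = k" by (simp add: k_def add.commute)
      note Fb = fejer_poly_bounds[OF w, of "t + 1", folded F_def, unfolded kk]
      have Q: "poly (smult (1 / D) (pcompose F a)) m = poly F w / D"
        by (simp add: poly_pcompose pa w_def)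
      show "0 \<le> poly (smult (1 / D) (pcompose F a)) m" unfolding Q using Fb D0 by simp
      show "poly (smult (1 / D) (pcompose F a)) m \<le> 1" unfolding Q using Fb D0 Dk by simp
      have mc: "m + c = L * (w + x)" using L by (simp add: w_def x_def field_simps)
      \<comment> \<open>The factor \<open>m + c\<close> is split as \<open>w + x\<close> up to
        scale: decay of the kernel handles \<open>w\<close>, its maximum \<open>k\<close> handles
        \<open>x\<close>.\<close>
      have "x * poly F w \<le> x * k" using Fb x by (intro mult_left_mono) auto
      then have "(w + x) * poly F w \<le> 1 + k * x" using Fb by (simp add: algebra_simps)
      also have "\<dots> \<le> 4 * (1 + k * x / 4)" by simp
      also have "\<dots> \<le> 4 * (D / k)" using Dge k by (simp add: field_simps)
      finally have "(w + x) * poly F w \<le> 4 * (D / k)" .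
      then have "L * ((w + x) * poly F w) / D \<le> L * (4 * (D / k)) / D"
        using L D0 by (intro divide_right_mono mult_left_mono) auto
      then show "(m + c) * poly (smult (1 / D) (pcompose F a)) m \<le> 4 * (h - l) / (real t + 1)\<^sup>2"
        using D0 unfolding Q mc k_def[symmetric] L_def[symmetric] by (simp add: mult_ac)
    qed
  qed
qed

text \<open>The Kuczynski-Wozniakowski polynomial: on \<open>[l + \<epsilon>, h]\<close> the quantity \<open>(m - l - \<epsilon>) * (poly p m)\<^sup>2\<close>
  equioscillates. The value \<open>\<epsilon> = (h - l) * (tanh u)\<^sup>2\<close> makes \<open>l\<close> correspond to the argument
  \<open>- (sinh u)\<^sup>2\<close>.\<close>

lemma lanczos_poly:
  fixes l h \<beta> :: real
  assumes lh: "l < h" and \<beta>: "\<beta> \<ge> 1" and t: "t \<ge> 1"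
  obtains p M \<epsilon> where "degree p < t" "poly p l \<noteq> 0" "M > 0"
    "\<epsilon> \<le> (h - l) * (ln (4 * \<beta>))\<^sup>2 / (16 * (real t - 1 / 2)\<^sup>2)"
    "\<And>m. l \<le> m \<Longrightarrow> m \<le> h \<Longrightarrow> (m - l - \<epsilon>) * (poly p m)\<^sup>2 \<le> M"
    "M * (\<beta> - 1) \<le> \<epsilon> * (poly p l)\<^sup>2"
proof -
  define L where "L = h - l"
  have L: "L > 0" using lh by (simp add: L_def)
  \<comment> \<open>With degree \<open>n = t - 1\<close> this gives
    \<open>(2 * n + 1) * u = ln (4 * \<beta>) / 2\<close>, so the value of the polynomial at
    \<open>l\<close> is governed by \<open>\<beta>\<close>. The denominator is the source of
    \<open>t - 1 / 2\<close>.\<close>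
  define u where "u = ln (4 * \<beta>) / (2 * (2 * real t - 1))"
  have lnpos: "ln (4 * \<beta>) > 0" using \<beta> by simp
  have u: "u > 0" unfolding u_def using lnpos t by (intro divide_pos_pos) auto
  define n where "n = t - 1"
  have tn: "2 * real n + 1 = 2 * real t - 1" using t by (simp add: n_def)
  have "k * (y / (2 * k)) = y / 2" if "k > 0" for k y :: real using that by simp
  then have v: "(2 * real n + 1) * u = ln (4 * \<beta>) / 2"
    unfolding tn u_def by this (use t in simp)
  define G where "G = odd_sine_poly n"
  define M where "M = L / (cosh u)\<^sup>2"
  \<comment> \<open>Thus [l + \<epsilon>, h] has length \<open>M\<close>, and \<open>a\<close> maps
    it onto [0, 1].\<close>
  define \<epsilon> where "\<epsilon> = L - M"
  have M: "M > 0" using L by (simp add: M_def)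
  have \<epsilon>_M: "\<epsilon> = M * (sinh u)\<^sup>2"
  proof -
    have "L = M * (cosh u)\<^sup>2" by (simp add: M_def)
    then show ?thesis unfolding \<epsilon>_def cosh_square_eq by (simp add: algebra_simps)
  qed
  define a where "a = [:- (l + \<epsilon>) / M, 1 / M:]"
  have pa: "poly a m = (m - l - \<epsilon>) / M" for m by (simp add: a_def diff_divide_distrib add_divide_distrib)
  have al: "poly a l = - (sinh u)\<^sup>2" using M by (simp add: pa \<epsilon>_M)
  show ?thesis
  proof
    show "degree (pcompose G a) < t" using degree_odd_sine_poly[of n] t M
      by (simp add: G_def a_def n_def degree_pcompose)
    have Gl: "sinh u * poly (pcompose G a) l = sinh (ln (4 * \<beta>) / 2)"
      using odd_sine_poly_sinh[of u n] by (simp add: poly_pcompose al G_def v)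
    then show "poly (pcompose G a) l \<noteq> 0" using lnpos by auto
    show "M > 0" by fact
    have "\<epsilon> = L * (tanh u)\<^sup>2" by (simp add: \<epsilon>_M M_def tanh_def power_divide)
    also have "\<dots> \<le> L * u\<^sup>2" using L u tanh_real_le[of u] by (intro mult_left_mono power_mono) auto
    also have "\<dots> = (h - l) * (ln (4 * \<beta>))\<^sup>2 / (16 * (real t - 1 / 2)\<^sup>2)"
    proof -
      have u': "u = ln (4 * \<beta>) / (4 * (real t - 1 / 2))" by (simp add: u_def algebra_simps)
      show ?thesis unfolding u' L_def power_divide power_mult_distrib by simp
    qed
    finally show "\<epsilon> \<le> (h - l) * (ln (4 * \<beta>))\<^sup>2 / (16 * (real t - 1 / 2)\<^sup>2)" .
    show "(m - l - \<epsilon>) * (poly (pcompose G a) m)\<^sup>2 \<le> M" if m: "l \<le> m" "m \<le> h" for m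
    proof (cases "m - l \<le> \<epsilon>")
      case True
      then have "(m - l - \<epsilon>) * (poly (pcompose G a) m)\<^sup>2 \<le> 0" by (simp add: mult_nonpos_nonneg)
      then show ?thesis using M by linarith
    next
      case False
      define w where "w = (m - l - \<epsilon>) / M"
      have "0 \<le> w" "w \<le> 1" using False M m by (auto simp: w_def \<epsilon>_def L_def)
      from odd_sine_poly_bound[OF this, of n] have "M * (w * (poly G w)\<^sup>2) \<le> M * 1"
        unfolding G_def using M by (intro mult_left_mono) auto
      then show ?thesis using M by (simp add: poly_pcompose pa w_def)
    qed
    \<comment> \<open>The 4 inside the logarithm pays for the factor 1 / 2 in cosh x >= exp x /
      2.\<close>
    have "(exp (ln (4 * \<beta>) / 2))\<^sup>2 = 4 * \<beta>"
      using \<beta> by (simp add: exp_double[symmetric])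
    moreover have "exp (ln (4 * \<beta>) / 2) / 2 \<le> cosh (ln (4 * \<beta>) / 2)" by (simp add: cosh_field_def)
    then have "(exp (ln (4 * \<beta>) / 2) / 2)\<^sup>2 \<le> (cosh (ln (4 * \<beta>) / 2))\<^sup>2"
      by (intro power_mono) auto
    ultimately have "\<beta> - 1 \<le> (sinh (ln (4 * \<beta>) / 2))\<^sup>2"
      by (simp add: power_divide cosh_square_eq)
    also have "\<dots> = (sinh u)\<^sup>2 * (poly (pcompose G a) l)\<^sup>2"
      unfolding Gl[symmetric] by (simp add: power_mult_distrib)
    finally show "M * (\<beta> - 1) \<le> \<epsilon> * (poly (pcompose G a) l)\<^sup>2"
      using M unfolding \<epsilon>_M by (simp add: mult.assoc)
  qed
qed

section \<open>Polynomials in the Krylov space\<close>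

text \<open>The point is p(A) b. Recording only its inner products with eigenvectors keeps matrix
  polynomials out of the later arguments.\<close>

lemma poly_mul_vec_in_krylov:
  assumes "transpose A = A" "degree p < t"
  obtains z where "z \<in> krylov A b t"
    "\<And>v m. A *v v = m *\<^sub>R v \<Longrightarrow> v \<bullet> z = poly p m * (v \<bullet> b)"
proof
  let ?z = "\<Sum>i\<le>degree p. coeff p i *\<^sub>R ((\<lambda>v. A *v v) ^^ i) b"
  show "?z \<in> krylov A b t" unfolding krylov_def
    using assms(2) by (intro span_sum span_scale span_base) auto
  show "v \<bullet> ?z = poly p m * (v \<bullet> b)" if "A *v v = m *\<^sub>R v" for v m
  proof -
    have "v \<bullet> ((\<lambda>v. A *v v) ^^ i) b = m ^ i * (v \<bullet> b)" for i
      by (induction i) (simp_all add: symmetric_inner_mul_vec[OF assms(1), symmetric] that)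
    then show ?thesis
      by (simp add: inner_sum_right poly_altdef sum_distrib_left mult_ac)
  qed
qed

lemma subspace_krylov: "subspace (krylov A b t)"
  by (simp add: krylov_def)

text \<open>Stationarity says b = -(A + c I) xstar. Since 1 - Q vanishes at -c, it equals (m + c)
  r(m), and -r(A) b = (1 - Q(A)) xstar. Dividing out the root lowers the degree below
  \<open>t\<close>, as membership in the Krylov space requires.\<close>

lemma krylov_residual_poly:
  assumes sym: "transpose A = A" and stat: "(A + c *\<^sub>R mat 1) *v xstar + b = 0"
    and Q: "degree Q \<le> t" "poly Q (- c) = 1" and t: "t \<ge> 1"
  obtains y where "y \<in> krylov A b t"
    "\<And>v m. A *v v = m *\<^sub>R v \<Longrightarrow> v \<bullet> y = (1 - poly Q m) * (v \<bullet> xstar)"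
proof -
  have vb: "v \<bullet> b = - ((m + c) * (v \<bullet> xstar))" if "A *v v = m *\<^sub>R v" for v m
  proof -
    have "v \<bullet> (A *v xstar + c *\<^sub>R xstar + b) = 0"
      using stat by (simp add: matrix_vector_mult_add_rdistrib scaleR_matrix_vector_assoc[symmetric])
    then show ?thesis
      by (simp add: inner_add_right symmetric_inner_mul_vec[OF sym, symmetric] that algebra_simps)
  qed
  have "poly (1 - Q) (- c) = 0" using Q by simp
  then have "[:c, 1:] dvd 1 - Q" by (simp only: poly_eq_0_iff_dvd minus_minus)
  then obtain r where r: "1 - Q = [:c, 1:] * r" by (rule dvdE)
  have "degree r < t"
  proof (cases "r = 0")
    case False
    then have "degree (1 - Q) = Suc (degree r)" unfolding r by (subst degree_mult_eq) auto
    moreover have "degree (1 - Q) \<le> t" using Q by (auto intro!: degree_diff_le)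
    ultimately show ?thesis by simp
  qed (use t in simp)
  then have "degree (- r) < t" by simp
  from poly_mul_vec_in_krylov[OF sym this, of b] obtain y where
    y: "y \<in> krylov A b t" "\<And>v m. A *v v = m *\<^sub>R v \<Longrightarrow> v \<bullet> y = poly (- r) m * (v \<bullet> b)" by blast
  show ?thesis
  proof (rule that[OF y(1)])
    fix v m assume vm: "A *v v = m *\<^sub>R v"
    have "1 - poly Q m = poly ([:c, 1:] * r) m" unfolding r[symmetric] by simp
    then have Qr: "1 - poly Q m = (m + c) * poly r m" by (simp add: algebra_simps)
    show "v \<bullet> y = (1 - poly Q m) * (v \<bullet> xstar)"
      unfolding Qr y(2)[OF vm] vb[OF vm] by simp
  qed
qed

section \<open>Coordinates in an orthonormal eigenbasis\<close>

locale eigenbasis =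
  fixes A :: "real^'d^'d" and B :: "(real^'d) set" and e :: "real^'d \<Rightarrow> real"
  assumes sym: "transpose A = A" and finite_B: "finite B" and orth: "pairwise orthogonal B"
    and span_B: "span B = UNIV" and norm_B: "v \<in> B \<Longrightarrow> norm v = 1"
    and eig: "v \<in> B \<Longrightarrow> A *v v = e v *\<^sub>R v"
begin

lemma inner_eq: "x \<bullet> y = (\<Sum>v\<in>B. (v \<bullet> x) * (v \<bullet> y))"
proof -
  have "(\<Sum>v\<in>B. (x \<bullet> v) *\<^sub>R v) = x"
    by (rule orthonormal_basis_expand) (use orth norm_B span_B finite_B in auto)
  then have "x \<bullet> y = (\<Sum>v\<in>B. (x \<bullet> v) *\<^sub>R v) \<bullet> y" by simp
  also have "\<dots> = (\<Sum>v\<in>B. (v \<bullet> x) * (v \<bullet> y))"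
    unfolding inner_sum_left by (simp add: inner_commute)
  finally show ?thesis .
qed

lemma norm_square_eq: "(norm x)\<^sup>2 = (\<Sum>v\<in>B. (v \<bullet> x)\<^sup>2)"
  unfolding power2_norm_eq_inner inner_eq[of x x] by (simp only: power2_eq_square)

lemma inner_mul_vec: "v \<in> B \<Longrightarrow> v \<bullet> (A *v x) = e v * (v \<bullet> x)"
  by (simp add: symmetric_inner_mul_vec[OF sym, symmetric] eig)

lemma quad_form_eq: "x \<bullet> (A *v x) = (\<Sum>v\<in>B. e v * (v \<bullet> x)\<^sup>2)"
  unfolding inner_eq[of x "A *v x"]
  by (intro sum.cong refl) (simp add: inner_mul_vec power2_eq_square)

lemma quad_obj_eq: "quad_obj A b x = (\<Sum>v\<in>B. e v / 2 * (v \<bullet> x)\<^sup>2 + (v \<bullet> b) * (v \<bullet> x))"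
  by (simp add: quad_obj_def quad_form_eq inner_eq[of b x] sum.distrib sum_divide_distrib)

text \<open>Finiteness of the spectrum follows, so \<open>Min\<close> and \<open>Max\<close> do
  bound \<open>e\<close>. Any eigenvector has a nonzero coordinate in the basis, and comparing that
  coordinate before and after applying \<open>A\<close> fixes its eigenvalue.\<close>

lemma eigenvalues_eq: "eigenvalues A = e ` B"
proof
  show "e ` B \<subseteq> eigenvalues A"
  proof
    fix l assume "l \<in> e ` B"
    then obtain v where "v \<in> B" "l = e v" by blast
    then show "l \<in> eigenvalues A" using eig[of v] norm_B[of v] unfolding eigenvalues_def
      by (intro CollectI exI[of _ v]) auto
  qed
  show "eigenvalues A \<subseteq> e ` B"
  proof
    fix l assume "l \<in> eigenvalues A"
    then obtain w where w: "w \<noteq> 0" "A *v w = l *\<^sub>R w" by (auto simp: eigenvalues_def)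
    have "\<exists>v\<in>B. v \<bullet> w \<noteq> 0"
    proof (rule ccontr)
      assume "\<not> ?thesis"
      then have "w \<bullet> w = 0" unfolding inner_eq[of w w] by simp
      then show False using w by simp
    qed
    then obtain v where v: "v \<in> B" "v \<bullet> w \<noteq> 0" by blast
    then have "l = e v" using inner_mul_vec[OF v(1), of w] w by simp
    then show "l \<in> e ` B" using v by blast
  qed
qed

lemma eigenvalue_bounds:
  assumes "v \<in> B"
  shows "lambda_min A \<le> e v" "e v \<le> lambda_max A"
  using assms finite_B by (auto simp: lambda_min_def lambda_max_def eigenvalues_eq)

text \<open>Subtracting \<open>s / 2 * (norm x)\<^sup>2\<close> shifts the spectrum by \<open>- s\<close>. The same identity is used with
  \<open>s = 0\<close>, with \<open>s = lambda_min A\<close>, and with \<open>s = - c\<close>.\<close>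

lemma quad_obj_gap:
  assumes stat: "(A + c *\<^sub>R mat 1) *v xstar + b = 0"
  shows "(quad_obj A b y - s / 2 * (norm y)\<^sup>2) - (quad_obj A b xstar - s / 2 * (norm xstar)\<^sup>2)
    = (\<Sum>v\<in>B. (e v - s) / 2 * ((v \<bullet> y)\<^sup>2 - (v \<bullet> xstar)\<^sup>2)
        - (e v + c) * (v \<bullet> xstar) * (v \<bullet> y - v \<bullet> xstar))"
proof -
  have vb: "v \<bullet> b = - ((e v + c) * (v \<bullet> xstar))" if "v \<in> B" for v
  proof -
    have "v \<bullet> (A *v xstar + c *\<^sub>R xstar + b) = 0"
      using stat by (simp add: matrix_vector_mult_add_rdistrib scaleR_matrix_vector_assoc[symmetric])
    then show ?thesis
      by (simp add: inner_add_right inner_mul_vec that algebra_simps)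
  qed
  show ?thesis
    unfolding quad_obj_eq norm_square_eq sum_distrib_left sum_subtractf[symmetric]
    by (intro sum.cong refl) (simp add: vb field_simps)
qed

section \<open>Gap estimates for explicit Krylov points\<close>

lemma lambda_min_le_max: "lambda_min A \<le> lambda_max A"
proof -
  have "B \<noteq> {}"
  proof
    assume "B = {}"
    then have "(UNIV :: (real^'d) set) = {0}" using span_B by simp
    then have "(axis undefined 1 :: real^'d) = 0" by blast
    then show False by (simp add: axis_eq_0_iff)
  qed
  then obtain v where "v \<in> B" by blast
  then show ?thesis using eigenvalue_bounds[of v] by linarith
qed

text \<open>The residual \<open>Q(A) xstar\<close> is small relative to \<open>xstar\<close> in every spectral component, so rescaling
  the iterate to the sphere through \<open>xstar\<close>, where the multiplier term of the gap vanishes, costs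
  only a constant factor.\<close>

lemma krylov_geometric_gap:
  assumes stat: "(A + c *\<^sub>R mat 1) *v xstar + b = 0" and c: "c \<ge> 0"
    and pos: "lambda_min A + c > 0" and t: "t \<ge> 1"
    and \<delta>_def: "\<delta> = 2 * exp (- 2 * real t * sqrt ((lambda_min A + c) / (lambda_max A + c)))"
    and \<delta>: "\<delta> \<le> 1 / 3" and nz: "xstar \<noteq> 0"
  obtains y where "y \<in> krylov A b t" "norm y = norm xstar"
    "quad_obj A b y - quad_obj A b xstar \<le> 9 * \<delta>\<^sup>2 * (quad_obj A b 0 - quad_obj A b xstar)"
proof -
  obtain Q where Q: "degree Q \<le> t" "poly Q (- c) = 1"
    "\<And>m. lambda_min A \<le> m \<Longrightarrow> m \<le> lambda_max A \<Longrightarrow> \<bar>poly Q m\<bar> \<le> \<delta>"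
    by (rule geometric_residual_poly[OF lambda_min_le_max pos t, folded \<delta>_def]) blast
  have \<delta>0: "\<delta> > 0" by (simp add: \<delta>_def)
  obtain z where z: "z \<in> krylov A b t"
    "\<And>v m. A *v v = m *\<^sub>R v \<Longrightarrow> v \<bullet> z = (1 - poly Q m) * (v \<bullet> xstar)"
    by (rule krylov_residual_poly[OF sym stat Q(1,2) t]) blast
  define q where "q v = poly Q (e v)" for v
  have q: "\<bar>q v\<bar> \<le> \<delta>" if "v \<in> B" for v
    unfolding q_def by (intro Q eigenvalue_bounds that)
  have vz: "v \<bullet> z = (1 - q v) * (v \<bullet> xstar)" if "v \<in> B" for v
    unfolding q_def by (intro z eig that)
  have "(norm z)\<^sup>2 \<le> ((1 + \<delta>) * norm xstar)\<^sup>2"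
    unfolding power_mult_distrib norm_square_eq sum_distrib_left
  proof (intro sum_mono)
    fix v assume v: "v \<in> B"
    have "0 \<le> 1 - q v" "1 - q v \<le> 1 + \<delta>" using q[OF v] \<delta> by linarith+
    then have "(1 - q v)\<^sup>2 \<le> (1 + \<delta>)\<^sup>2" by (intro power_mono)
    then show "(v \<bullet> z)\<^sup>2 \<le> (1 + \<delta>)\<^sup>2 * (v \<bullet> xstar)\<^sup>2"
      unfolding vz[OF v] power_mult_distrib by (intro mult_right_mono) auto
  qed
  then have nz_le: "norm z \<le> (1 + \<delta>) * norm xstar" 
    by (rule power2_le_imp_le) (use \<delta>0 in simp)
  have "((1 - \<delta>) * norm xstar)\<^sup>2 \<le> (norm z)\<^sup>2"
    unfolding power_mult_distrib norm_square_eq sum_distrib_left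
  proof (intro sum_mono)
    fix v assume v: "v \<in> B"
    have "0 \<le> 1 - \<delta>" "1 - \<delta> \<le> 1 - q v" using q[OF v] \<delta> by linarith+
    then have "(1 - \<delta>)\<^sup>2 \<le> (1 - q v)\<^sup>2" by (intro power_mono)
    then show "(1 - \<delta>)\<^sup>2 * (v \<bullet> xstar)\<^sup>2 \<le> (v \<bullet> z)\<^sup>2"
      unfolding vz[OF v] power_mult_distrib by (intro mult_right_mono) auto
  qed
  then have nz_ge: "(1 - \<delta>) * norm xstar \<le> norm z" by (rule power2_le_imp_le) simp
  have nx: "norm xstar > 0" using nz by simp
  have nzp: "norm z > 0"
    using nz_ge nx \<delta> mult_pos_pos[of "1 - \<delta>" "norm xstar"] by linarith
  define a where "a = norm xstar / norm z"
  have a0: "a > 0" using nx nzp by (simp add: a_def)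
  have a_le: "a * (1 - \<delta>) \<le> 1" using nz_ge nzp by (simp add: a_def field_simps)
  have a_ge: "a * (1 + \<delta>) \<ge> 1" using nz_le nzp by (simp add: a_def field_simps)
  have "a * (2 / 3) \<le> a * (1 - \<delta>)" using a0 \<delta> by (intro mult_left_mono) auto
  then have "a \<le> 3 / 2" using a_le by linarith
  then have a_\<delta>: "a * \<delta> \<le> 3 / 2 * \<delta>" using \<delta>0 by (intro mult_right_mono) auto
  \<comment> \<open>Since a (1 - \<delta>) <= 1 <= a (1 + \<delta>), both \<open>a - 1\<close> and
    \<open>a * q v\<close> are at most \<open>a * \<delta>\<close> in absolute value, and a <= 3 /
    2.\<close>
  have dev: "\<bar>a * (1 - q v) - 1\<bar> \<le> 3 * \<delta>" if "v \<in> B" for v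
  proof -
    have "\<bar>a * q v\<bar> \<le> a * \<delta>" using q[OF that] a0 by (simp add: abs_mult)
    then show ?thesis using a_le a_ge a_\<delta> unfolding right_diff_distrib distrib_left by linarith
  qed
  have gap: "quad_obj A b y - quad_obj A b xstar = (\<Sum>v\<in>B. (e v + c) / 2 * (v \<bullet> y - v \<bullet> xstar)\<^sup>2)
      + c / 2 * ((norm xstar)\<^sup>2 - (norm y)\<^sup>2)" for y
  proof -
    have "(\<Sum>v\<in>B. (e v - - c) / 2 * ((v \<bullet> y)\<^sup>2 - (v \<bullet> xstar)\<^sup>2)
        - (e v + c) * (v \<bullet> xstar) * (v \<bullet> y - v \<bullet> xstar))
      = (\<Sum>v\<in>B. (e v + c) / 2 * (v \<bullet> y - v \<bullet> xstar)\<^sup>2)"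
      by (intro sum.cong refl) (simp add: power2_eq_square field_simps)
    then show ?thesis using quad_obj_gap[OF stat, of y "- c"] by (simp add: algebra_simps)
  qed
  have ev: "e v + c \<ge> 0" if "v \<in> B" for v using eigenvalue_bounds[OF that] pos by linarith
  show ?thesis
  proof
    show "a *\<^sub>R z \<in> krylov A b t" using z(1) by (simp add: subspace_krylov subspace_scale)
    show n: "norm (a *\<^sub>R z) = norm xstar" using nzp by (simp add: a_def)
    have "quad_obj A b (a *\<^sub>R z) - quad_obj A b xstar
        = (\<Sum>v\<in>B. (e v + c) / 2 * (v \<bullet> (a *\<^sub>R z) - v \<bullet> xstar)\<^sup>2)"
      using gap[of "a *\<^sub>R z"] n by simp
    also have "\<dots> \<le> (\<Sum>v\<in>B. 9 * \<delta>\<^sup>2 * ((e v + c) / 2 * (v \<bullet> 0 - v \<bullet> xstar)\<^sup>2))"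
    proof (intro sum_mono)
      fix v assume v: "v \<in> B"
      have "v \<bullet> (a *\<^sub>R z) - v \<bullet> xstar = (a * (1 - q v) - 1) * (v \<bullet> xstar)"
        by (simp add: vz[OF v] algebra_simps)
      moreover have "(a * (1 - q v) - 1)\<^sup>2 \<le> (3 * \<delta>)\<^sup>2"
        using power_mono[OF dev[OF v] abs_ge_zero, of 2] by simp
      ultimately have "(v \<bullet> (a *\<^sub>R z) - v \<bullet> xstar)\<^sup>2 \<le> 9 * \<delta>\<^sup>2 * (v \<bullet> xstar)\<^sup>2"
        using mult_right_mono[of "(a * (1 - q v) - 1)\<^sup>2" "(3 * \<delta>)\<^sup>2" "(v \<bullet> xstar)\<^sup>2"]
        by (simp add: power_mult_distrib)
      from mult_left_mono[OF this, of "(e v + c) / 2"]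
      show "(e v + c) / 2 * (v \<bullet> (a *\<^sub>R z) - v \<bullet> xstar)\<^sup>2
          \<le> 9 * \<delta>\<^sup>2 * ((e v + c) / 2 * (v \<bullet> 0 - v \<bullet> xstar)\<^sup>2)"
        using ev[OF v] by (simp add: mult_ac)
    qed
    also have "\<dots> = 9 * \<delta>\<^sup>2 * (\<Sum>v\<in>B. (e v + c) / 2 * (v \<bullet> 0 - v \<bullet> xstar)\<^sup>2)"
      by (simp add: sum_distrib_left)
    also have "\<dots> \<le> 9 * \<delta>\<^sup>2 * (quad_obj A b 0 - quad_obj A b xstar)"
      using c by (intro mult_left_mono) (simp_all add: gap[of 0])
    finally show "quad_obj A b (a *\<^sub>R z) - quad_obj A b xstar
        \<le> 9 * \<delta>\<^sup>2 * (quad_obj A b 0 - quad_obj A b xstar)" .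
  qed
qed

lemma krylov_sublinear_gap:
  assumes stat: "(A + c *\<^sub>R mat 1) *v xstar + b = 0"
    and s: "s \<le> lambda_min A" "c + s \<ge> 0" and t: "t \<ge> 1"
  obtains y where "y \<in> krylov A b t" "norm y \<le> norm xstar"
    "(quad_obj A b y - s / 2 * (norm y)\<^sup>2) - (quad_obj A b xstar - s / 2 * (norm xstar)\<^sup>2)
      \<le> 4 * (lambda_max A - lambda_min A) * (norm xstar)\<^sup>2 / (real t + 1)\<^sup>2"
proof -
  define K where "K = 4 * (lambda_max A - lambda_min A) / (real t + 1)\<^sup>2"
  have nonneg: "lambda_min A + c \<ge> 0" using s by linarith
  obtain Q where Q: "degree Q \<le> t" "poly Q (- c) = 1"
    "\<And>m. lambda_min A \<le> m \<Longrightarrow> m \<le> lambda_max A \<Longrightarrow> 0 \<le> poly Q m"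
    "\<And>m. lambda_min A \<le> m \<Longrightarrow> m \<le> lambda_max A \<Longrightarrow> poly Q m \<le> 1"
    "\<And>m. lambda_min A \<le> m \<Longrightarrow> m \<le> lambda_max A \<Longrightarrow> (m + c) * poly Q m \<le> K"
    by (rule sublinear_residual_poly[OF lambda_min_le_max nonneg t, folded K_def]) blast
  obtain y where y: "y \<in> krylov A b t"
    "\<And>v m. A *v v = m *\<^sub>R v \<Longrightarrow> v \<bullet> y = (1 - poly Q m) * (v \<bullet> xstar)"
    by (rule krylov_residual_poly[OF sym stat Q(1,2) t]) blast
  define q where "q v = poly Q (e v)" for v
  have q: "0 \<le> q v" "q v \<le> 1" "(e v + c) * q v \<le> K" if "v \<in> B" for v
    unfolding q_def by (intro Q eigenvalue_bounds that)+
  have vy: "v \<bullet> y = (1 - q v) * (v \<bullet> xstar)" if "v \<in> B" for v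
    unfolding q_def by (intro y eig that)
  show ?thesis
  proof
    show "y \<in> krylov A b t" by fact
    have "(norm y)\<^sup>2 \<le> (norm xstar)\<^sup>2"
      unfolding norm_square_eq
    proof (intro sum_mono)
      fix v assume v: "v \<in> B"
      have "(1 - q v)\<^sup>2 \<le> 1" using q[OF v] by (simp add: abs_square_le_1)
      then show "(v \<bullet> y)\<^sup>2 \<le> (v \<bullet> xstar)\<^sup>2"
        unfolding vy[OF v] power_mult_distrib by (simp add: mult_left_le_one_le)
    qed
    then show "norm y \<le> norm xstar" by (rule power2_le_imp_le) simp
    have "(quad_obj A b y - s / 2 * (norm y)\<^sup>2) - (quad_obj A b xstar - s / 2 * (norm xstar)\<^sup>2)
      = (\<Sum>v\<in>B. (e v - s) / 2 * ((v \<bullet> y)\<^sup>2 - (v \<bullet> xstar)\<^sup>2)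
        - (e v + c) * (v \<bullet> xstar) * (v \<bullet> y - v \<bullet> xstar))"
      by (rule quad_obj_gap[OF stat])
    also have "\<dots> \<le> (\<Sum>v\<in>B. K * (v \<bullet> xstar)\<^sup>2)"
    proof (intro sum_mono)
      fix v assume v: "v \<in> B"
      have es: "0 \<le> e v - s" using eigenvalue_bounds[OF v] s by linarith
      have "(e v - s) / 2 * ((v \<bullet> y)\<^sup>2 - (v \<bullet> xstar)\<^sup>2)
        - (e v + c) * (v \<bullet> xstar) * (v \<bullet> y - v \<bullet> xstar)
        = ((e v - s) / 2 * (q v * q v) + (c + s) * q v) * (v \<bullet> xstar)\<^sup>2"
        by (simp add: vy[OF v] power2_eq_square field_simps)
      also have "\<dots> \<le> K * (v \<bullet> xstar)\<^sup>2"
      proof (intro mult_right_mono)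
        \<comment> \<open>Bounding q^2 / 2 by q merges both terms into
          \<open>(e v + c) * q v\<close>, the quantity that the residual polynomial
          controls.\<close>
        have "(e v - s) / 2 * (q v * q v) \<le> (e v - s) * (q v * 1)"
          using es q[OF v] by (intro mult_mono) auto
        then have "(e v - s) / 2 * (q v * q v) + (c + s) * q v \<le> (e v + c) * q v"
          by (simp add: algebra_simps)
        also have "\<dots> \<le> K" by (rule q(3)[OF v])
        finally show "(e v - s) / 2 * (q v * q v) + (c + s) * q v \<le> K" .
      qed simp
      finally show "(e v - s) / 2 * ((v \<bullet> y)\<^sup>2 - (v \<bullet> xstar)\<^sup>2)
        - (e v + c) * (v \<bullet> xstar) * (v \<bullet> y - v \<bullet> xstar) \<le> K * (v \<bullet> xstar)\<^sup>2" .
    qed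
    also have "\<dots> = 4 * (lambda_max A - lambda_min A) * (norm xstar)\<^sup>2 / (real t + 1)\<^sup>2"
      unfolding sum_distrib_left[symmetric] norm_square_eq[symmetric] by (simp add: K_def)
    finally show "(quad_obj A b y - s / 2 * (norm y)\<^sup>2) - (quad_obj A b xstar - s / 2 * (norm xstar)\<^sup>2)
      \<le> 4 * (lambda_max A - lambda_min A) * (norm xstar)\<^sup>2 / (real t + 1)\<^sup>2" .
  qed
qed

text \<open>Take z = p(A) b with \<open>p\<close> from \<open>lanczos_poly\<close>. After
  subtracting \<epsilon> times the squared norm, the coordinates other than \<open>u\<close>
  contribute at most \<open>M * (\<beta> - 1) * (u \<bullet> b)\<^sup>2\<close>, and the negative
  contribution of \<open>u\<close> cancels this.\<close>

lemma krylov_approx_min_eigenvector: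
  assumes u: "u \<in> B" "e u = lambda_min A" and ub: "u \<bullet> b \<noteq> 0" and t: "t \<ge> 1"
  obtains z where "z \<in> krylov A b t" "z \<noteq> 0"
    "z \<bullet> (A *v z) - lambda_min A * (norm z)\<^sup>2
      \<le> (lambda_max A - lambda_min A) * (ln (4 * ((norm b)\<^sup>2 / (u \<bullet> b)\<^sup>2)))\<^sup>2
          / (16 * (real t - 1 / 2)\<^sup>2) * (norm z)\<^sup>2"
proof (cases "lambda_min A < lambda_max A")
  case False
  then have eq: "lambda_max A = lambda_min A" using lambda_min_le_max by simp
  have b: "b \<noteq> 0" using ub by auto
  have ev: "e v = lambda_min A" if "v \<in> B" for v using eigenvalue_bounds[OF that] eq by simp
  show ?thesis
  proof
    show "b \<in> krylov A b t"
      \<comment> \<open>All eigenvalues coincide here, so \<open>b\<close>, the generator of index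
        0, already attains the minimal Rayleigh quotient.\<close>
      unfolding krylov_def using t by (intro span_base image_eqI[where x = 0]) auto
    have "b \<bullet> (A *v b) = lambda_min A * (norm b)\<^sup>2"
      by (simp add: quad_form_eq norm_square_eq sum_distrib_left ev)
    then show "b \<bullet> (A *v b) - lambda_min A * (norm b)\<^sup>2
      \<le> (lambda_max A - lambda_min A) * (ln (4 * ((norm b)\<^sup>2 / (u \<bullet> b)\<^sup>2)))\<^sup>2
          / (16 * (real t - 1 / 2)\<^sup>2) * (norm b)\<^sup>2"
      by (simp add: eq)
  qed (fact b)
next
  case True
  define \<beta> where "\<beta> = (norm b)\<^sup>2 / (u \<bullet> b)\<^sup>2"
  have ub2: "(u \<bullet> b)\<^sup>2 > 0" using ub by simp
  have "(u \<bullet> b)\<^sup>2 \<le> (norm b)\<^sup>2" unfolding norm_square_eq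
    by (rule member_le_sum[OF u(1)]) (use finite_B in auto)
  then have \<beta>: "\<beta> \<ge> 1" using ub2 by (simp add: \<beta>_def)
  have \<beta>b: "(norm b)\<^sup>2 = \<beta> * (u \<bullet> b)\<^sup>2" using ub2 by (simp add: \<beta>_def)
  define E where "E = (lambda_max A - lambda_min A) * (ln (4 * \<beta>))\<^sup>2 / (16 * (real t - 1 / 2)\<^sup>2)"
  obtain p M \<epsilon> where p: "degree p < t" "poly p (lambda_min A) \<noteq> 0" "M > 0" "\<epsilon> \<le> E"
    "\<And>m. lambda_min A \<le> m \<Longrightarrow> m \<le> lambda_max A \<Longrightarrow> (m - lambda_min A - \<epsilon>) * (poly p m)\<^sup>2 \<le> M"
    "M * (\<beta> - 1) \<le> \<epsilon> * (poly p (lambda_min A))\<^sup>2"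
    by (rule lanczos_poly[OF True \<beta> t, folded E_def]) blast
  obtain z where z: "z \<in> krylov A b t" "\<And>v m. A *v v = m *\<^sub>R v \<Longrightarrow> v \<bullet> z = poly p m * (v \<bullet> b)"
    by (rule poly_mul_vec_in_krylov[OF sym p(1), of b]) blast
  have vz: "v \<bullet> z = poly p (e v) * (v \<bullet> b)" if "v \<in> B" for v by (intro z eig that)
  show ?thesis
  proof
    show "z \<in> krylov A b t" by fact
    have "u \<bullet> z \<noteq> 0" using vz[OF u(1)] p(2) ub u(2) by simp
    then show "z \<noteq> 0" by auto
    have "z \<bullet> (A *v z) - lambda_min A * (norm z)\<^sup>2 - \<epsilon> * (norm z)\<^sup>2
      = (\<Sum>v\<in>B. (e v - lambda_min A - \<epsilon>) * (v \<bullet> z)\<^sup>2)"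
      unfolding quad_form_eq norm_square_eq
      by (simp add: sum_distrib_left sum_subtractf[symmetric] algebra_simps)
    also have "\<dots> = - \<epsilon> * (u \<bullet> z)\<^sup>2 + (\<Sum>v\<in>B - {u}. (e v - lambda_min A - \<epsilon>) * (v \<bullet> z)\<^sup>2)"
      by (subst sum.remove[OF finite_B u(1)]) (simp add: u(2))
    also have "\<dots> \<le> - (M * (\<beta> - 1) * (u \<bullet> b)\<^sup>2) + (\<Sum>v\<in>B - {u}. M * (v \<bullet> b)\<^sup>2)"
    proof (intro add_mono sum_mono)
      have "M * (\<beta> - 1) * (u \<bullet> b)\<^sup>2 \<le> \<epsilon> * (poly p (lambda_min A))\<^sup>2 * (u \<bullet> b)\<^sup>2"
        using p(6) by (intro mult_right_mono) auto
      then show "- \<epsilon> * (u \<bullet> z)\<^sup>2 \<le> - (M * (\<beta> - 1) * (u \<bullet> b)\<^sup>2)"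
        by (simp add: vz[OF u(1)] u(2) power_mult_distrib mult.assoc)
    next
      fix v assume "v \<in> B - {u}"
      then have v: "v \<in> B" by simp
      from mult_right_mono[OF p(5)[OF eigenvalue_bounds[OF v]], of "(v \<bullet> b)\<^sup>2"]
      show "(e v - lambda_min A - \<epsilon>) * (v \<bullet> z)\<^sup>2 \<le> M * (v \<bullet> b)\<^sup>2"
        by (simp add: vz[OF v] power_mult_distrib mult.assoc)
    qed
    also have "(\<Sum>v\<in>B - {u}. M * (v \<bullet> b)\<^sup>2) = M * ((norm b)\<^sup>2 - (u \<bullet> b)\<^sup>2)"
      unfolding norm_square_eq sum.remove[OF finite_B u(1)] by (simp add: sum_distrib_left)
    also have "- (M * (\<beta> - 1) * (u \<bullet> b)\<^sup>2) + M * ((norm b)\<^sup>2 - (u \<bullet> b)\<^sup>2) = 0"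
      unfolding \<beta>b by (simp add: algebra_simps)
    finally have "z \<bullet> (A *v z) - lambda_min A * (norm z)\<^sup>2 \<le> \<epsilon> * (norm z)\<^sup>2" by simp
    also have "\<dots> \<le> E * (norm z)\<^sup>2" using p(4) by (intro mult_right_mono) auto
    finally show "z \<bullet> (A *v z) - lambda_min A * (norm z)\<^sup>2
      \<le> (lambda_max A - lambda_min A) * (ln (4 * ((norm b)\<^sup>2 / (u \<bullet> b)\<^sup>2)))\<^sup>2
          / (16 * (real t - 1 / 2)\<^sup>2) * (norm z)\<^sup>2"
      unfolding E_def \<beta>_def .
  qed
qed

end

section \<open>The trust region gap\<close>

lemma quad_obj_shifted_expand:
  assumes sym: "transpose A = A"
  shows "quad_obj A b (y + \<alpha> *\<^sub>R z) - s / 2 * (norm (y + \<alpha> *\<^sub>R z))\<^sup>2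
    = (quad_obj A b y - s / 2 * (norm y)\<^sup>2) + \<alpha> * ((A *v y + b - s *\<^sub>R y) \<bullet> z)
      + \<alpha>\<^sup>2 / 2 * (z \<bullet> (A *v z) - s * (norm z)\<^sup>2)"
proof -
  have "(norm (y + \<alpha> *\<^sub>R z))\<^sup>2 = (norm y)\<^sup>2 + 2 * \<alpha> * (y \<bullet> z) + \<alpha>\<^sup>2 * (norm z)\<^sup>2"
    unfolding power2_norm_eq_inner
    by (simp add: inner_add_left inner_add_right inner_commute power2_eq_square)
  moreover have "(y + \<alpha> *\<^sub>R z) \<bullet> (A *v (y + \<alpha> *\<^sub>R z))
      = y \<bullet> (A *v y) + 2 * \<alpha> * ((A *v y) \<bullet> z) + \<alpha>\<^sup>2 * (z \<bullet> (A *v z))"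
    using symmetric_inner_mul_vec[OF sym, of y z]
    by (simp add: matrix_vector_right_distrib matrix_vector_mult_scaleR inner_add_left
        inner_add_right inner_commute power2_eq_square algebra_simps)
  ultimately show ?thesis
    by (simp add: quad_obj_def inner_add_left inner_add_right inner_diff_left field_simps)
qed

text \<open>Intermediate value theorem along the ray: it starts in the ball, and after a
  displacement of length \<open>2 * R\<close> the triangle inequality puts it on or outside the
  sphere.\<close>

lemma exists_scale_to_sphere:
  fixes y z :: "'a :: real_inner"
  assumes y: "norm y \<le> R" and z: "z \<noteq> 0"
  obtains \<alpha> where "0 \<le> \<alpha>" "norm (y + \<alpha> *\<^sub>R z) = R" "\<alpha> * norm z \<le> 2 * R"
proof -
  have R: "R \<ge> 0" using y norm_ge_zero[of y] by linarith
  define T where "T = 2 * R / norm z"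
  have T: "T \<ge> 0" "T * norm z = 2 * R" using R z by (simp_all add: T_def)
  have "norm (T *\<^sub>R z) \<le> norm (y + T *\<^sub>R z) + norm y"
    using norm_triangle_ineq4[of "y + T *\<^sub>R z" y] by simp
  then have "R \<le> norm (y + T *\<^sub>R z)" using T y by simp
  moreover have "continuous_on {0..T} (\<lambda>\<alpha>. norm (y + \<alpha> *\<^sub>R z))" by (intro continuous_intros)
  ultimately obtain \<alpha> where \<alpha>: "0 \<le> \<alpha>" "\<alpha> \<le> T" "norm (y + \<alpha> *\<^sub>R z) = R"
    using IVT'[of "\<lambda>\<alpha>. norm (y + \<alpha> *\<^sub>R z)" 0 R T] y T by auto
  have "\<alpha> * norm z \<le> T * norm z" using \<alpha> by (intro mult_right_mono) auto
  with \<alpha> T show ?thesis using that by simp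
qed

text \<open>Division by zero yields 0, which is the stated convention for the ratio in the first
  bound. The implication before the second bound expresses that it is vacuous for negative
  \<open>lambda_min A\<close> and \<open>vmin \<bullet> b = 0\<close>.\<close>

theorem theorem4p1:
  fixes A :: "real^'d^'d" and b xstar vmin :: "real^'d"
    and R ltr :: real and x :: "nat \<Rightarrow> real^'d"
  assumes sym: "transpose A = A"
    and R: "R > 0"
    and xstar: "is_arg_min (quad_obj A b) (\<lambda>y. norm y \<le> R) xstar"
    and stationary: "(A + ltr *\<^sub>R mat 1) *v xstar + b = 0"
    and ltr_ge: "ltr \<ge> max (- lambda_min A) 0"
    and complementarity: "ltr * (R - norm xstar) = 0"
    and vmin_unit: "norm vmin = 1"
    and vmin_eigen: "A *v vmin = lambda_min A *\<^sub>R vmin"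
    and x: "\<And>t. t \<ge> 1 \<Longrightarrow>
      is_arg_min (quad_obj A b) (\<lambda>y. y \<in> krylov A b t \<and> norm y \<le> R) (x t)"
  shows "\<forall>t\<ge>1.
    quad_obj A b (x t) - quad_obj A b xstar
      \<le> 36 * (quad_obj A b 0 - quad_obj A b xstar)
          * exp (- 4 * real t * sqrt ((lambda_min A + ltr) / (lambda_max A + ltr))) \<and>
    ((lambda_min A < 0 \<longrightarrow> vmin \<bullet> b \<noteq> 0) \<longrightarrow>
     quad_obj A b (x t) - quad_obj A b xstar
      \<le> (lambda_max A - lambda_min A) * (norm xstar)\<^sup>2 / (real t - 1 / 2)\<^sup>2
          * (4 + of_bool (lambda_min A < 0) / 8
                   * (ln (4 * (norm b)\<^sup>2 / (vmin \<bullet> b)\<^sup>2))\<^sup>2))"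
proof (intro allI impI)
  fix t :: nat
  assume t: "t \<ge> 1"
  let ?f = "quad_obj A b"
  define l h where "l = lambda_min A" and "h = lambda_max A"
  obtain B where B: "vmin \<in> B" "finite B" "pairwise orthogonal B" "span B = UNIV"
    "\<And>v. v \<in> B \<Longrightarrow> norm v = 1" "\<And>v. v \<in> B \<Longrightarrow> A *v v = (v \<bullet> (A *v v)) *\<^sub>R v"
    by (rule spectral_theorem_extending[OF sym vmin_unit vmin_eigen]) blast
  interpret eigenbasis A B "\<lambda>v. v \<bullet> (A *v v)"
    using sym B by unfold_locales auto
  have evmin: "vmin \<bullet> (A *v vmin) = lambda_min A"
    using vmin_unit by (simp add: vmin_eigen dot_square_norm)
  have lh: "l \<le> h" unfolding l_def h_def by (rule lambda_min_le_max)
  have ltr: "ltr \<ge> 0" "l + ltr \<ge> 0" using ltr_ge by (auto simp: l_def)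
  have xsR: "norm xstar \<le> R" using xstar by (simp add: is_arg_min_linorder)
  have xs_min: "?f xstar \<le> ?f y" if "norm y \<le> R" for y
    using xstar that by (simp add: is_arg_min_linorder)
  have xt_min: "?f (x t) \<le> ?f y" if "y \<in> krylov A b t" "norm y \<le> R" for y
    using x[OF t] that by (simp add: is_arg_min_linorder)
  have xt0: "?f (x t) \<le> ?f 0"
    by (rule xt_min) (use R subspace_0[OF subspace_krylov] in auto)
  have gap0: "0 \<le> ?f 0 - ?f xstar" using xs_min[of 0] R by simp
  define E where "E = exp (- 4 * real t * sqrt ((l + ltr) / (h + ltr)))"
  have first: "?f (x t) - ?f xstar \<le> 36 * (?f 0 - ?f xstar) * E"
  proof (cases "36 * E \<ge> 1")
    case True
    have "1 * (?f 0 - ?f xstar) \<le> 36 * E * (?f 0 - ?f xstar)"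
      using True gap0 by (intro mult_right_mono) auto
    then show ?thesis using xt0 by (simp add: mult_ac)
  next
    case False
    define \<delta> where "\<delta> = 2 * exp (- 2 * real t * sqrt ((l + ltr) / (h + ltr)))"
    \<comment> \<open>Squaring the residual bound doubles its exponent to \<open>- 4 * t\<close>,
      and 36 is 9 from rescaling times 2^2 from cosh.\<close>
    have \<delta>E: "9 * \<delta>\<^sup>2 = 36 * E" by (simp add: \<delta>_def E_def power_mult_distrib exp_double[symmetric])
    have "(3 * \<delta>)\<^sup>2 \<le> 1\<^sup>2" using False \<delta>E by (simp add: power_mult_distrib)
    then have "3 * \<delta> \<le> 1" by (rule power2_le_imp_le) simp
    then have \<delta>: "\<delta> \<le> 1 / 3" by simp
    \<comment> \<open>A vanishing numerator would make the exponent 0, hence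
      \<open>E = 1\<close>.\<close>
    have "l + ltr \<noteq> 0" using False by (auto simp: E_def)
    then have pos: "l + ltr > 0" using ltr by simp
    show ?thesis
    proof (cases "xstar = 0")
      case True
      then show ?thesis using xt0 by simp
    next
      case nz: False
      obtain y where y: "y \<in> krylov A b t" "norm y = norm xstar"
        "?f y - ?f xstar \<le> 9 * \<delta>\<^sup>2 * (?f 0 - ?f xstar)"
        by (rule krylov_geometric_gap[OF stationary ltr(1) pos[unfolded l_def] t
            \<delta>_def[unfolded l_def h_def] \<delta> nz])
      then show ?thesis using xt_min[of y] xsR \<delta>E by (simp add: mult_ac)
    qed
  qed
  define a where "a = (h - l) * (norm xstar)\<^sup>2"
  have a: "a \<ge> 0" using lh by (simp add: a_def)
  have tpos: "real t - 1 / 2 > 0" using t by simp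
  \<comment> \<open>The Fejer rate is weakened to the denominator of the Lanczos bound, so that the
    two can be added.\<close>
  have "(real t - 1 / 2)\<^sup>2 \<le> (real t + 1)\<^sup>2" using t by (intro power_mono) auto
  then have rate: "4 * a / (real t + 1)\<^sup>2 \<le> 4 * a / (real t - 1 / 2)\<^sup>2"
    using a tpos by (intro divide_left_mono) auto
  have second: "?f (x t) - ?f xstar \<le> a / (real t - 1 / 2)\<^sup>2
      * (4 + of_bool (l < 0) / 8 * (ln (4 * (norm b)\<^sup>2 / (vmin \<bullet> b)\<^sup>2))\<^sup>2)"
    if ub: "l < 0 \<longrightarrow> vmin \<bullet> b \<noteq> 0"
  proof -
    define s where "s = min l 0"
    have s: "s \<le> lambda_min A" "ltr + s \<ge> 0" using ltr by (auto simp: s_def l_def)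
    obtain y where y: "y \<in> krylov A b t" "norm y \<le> norm xstar"
      "(?f y - s / 2 * (norm y)\<^sup>2) - (?f xstar - s / 2 * (norm xstar)\<^sup>2)
        \<le> 4 * (lambda_max A - lambda_min A) * (norm xstar)\<^sup>2 / (real t + 1)\<^sup>2"
      by (rule krylov_sublinear_gap[OF stationary s t])
    have "4 * (lambda_max A - lambda_min A) * (norm xstar)\<^sup>2 = 4 * a"
      by (simp add: a_def l_def h_def)
    with y(3) have y_gap: "(?f y - s / 2 * (norm y)\<^sup>2) - (?f xstar - s / 2 * (norm xstar)\<^sup>2)
        \<le> 4 * a / (real t - 1 / 2)\<^sup>2"
      using rate by simp
    show ?thesis
    proof (cases "l < 0")
      case False
      then have "s = 0" by (simp add: s_def)
      then show ?thesis using y_gap xt_min[OF y(1)] y(2) xsR False by (simp add: mult.commute)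
    next
      case True
      then have sl: "s = lambda_min A" by (simp add: s_def l_def)
      \<comment> \<open>Negative curvature forces a positive multiplier, so complementarity puts
        \<open>xstar\<close> on the sphere.\<close>
      have "ltr > 0" using True ltr by linarith
      then have xsR: "norm xstar = R" using complementarity by simp
      define \<Lambda> where "\<Lambda> = (ln (4 * (norm b)\<^sup>2 / (vmin \<bullet> b)\<^sup>2))\<^sup>2"
      define \<epsilon> where "\<epsilon> = (h - l) * \<Lambda> / (16 * (real t - 1 / 2)\<^sup>2)"
      have "vmin \<bullet> b \<noteq> 0" using ub True by simp
      from krylov_approx_min_eigenvector[OF B(1) evmin this t] obtain z0 where
        z0: "z0 \<in> krylov A b t" "z0 \<noteq> 0" "z0 \<bullet> (A *v z0) - s * (norm z0)\<^sup>2 \<le> \<epsilon> * (norm z0)\<^sup>2"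
        unfolding \<epsilon>_def \<Lambda>_def sl l_def h_def by (auto simp: mult_ac)
      \<comment> \<open>The Lanczos vector is determined only up to sign; this choice makes the
        linear term of the expansion nonpositive.\<close>
      define z where "z = (if (A *v y + b - s *\<^sub>R y) \<bullet> z0 \<le> 0 then z0 else - z0)"
      have zK: "z \<in> krylov A b t" using z0 by (simp add: z_def subspace_krylov subspace_neg)
      have znz: "z \<noteq> 0" using z0 by (simp add: z_def)
      have zray: "z \<bullet> (A *v z) - s * (norm z)\<^sup>2 \<le> \<epsilon> * (norm z)\<^sup>2"
        using z0(3) linear_neg[OF matrix_vector_mul_linear, of A z0] by (auto simp: z_def)
      have zdir: "(A *v y + b - s *\<^sub>R y) \<bullet> z \<le> 0" by (simp add: z_def)
      have "norm y \<le> R" using y(2) xsR by simp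
      from exists_scale_to_sphere[OF this znz] obtain \<alpha> where
        \<alpha>: "0 \<le> \<alpha>" "norm (y + \<alpha> *\<^sub>R z) = R" "\<alpha> * norm z \<le> 2 * R" .
      have \<epsilon>0: "\<epsilon> \<ge> 0" using lh by (simp add: \<epsilon>_def \<Lambda>_def)
      have "?f (x t) - ?f xstar \<le> ?f (y + \<alpha> *\<^sub>R z) - ?f xstar"
        using xt_min[of "y + \<alpha> *\<^sub>R z"] y(1) zK \<alpha>(2)
        by (simp add: subspace_krylov subspace_add subspace_scale)
      \<comment> \<open>Both points have norm \<open>R\<close>, so the shift contributes the same
        amount to each and cancels.\<close>
      also have "\<dots> = (?f (y + \<alpha> *\<^sub>R z) - s / 2 * (norm (y + \<alpha> *\<^sub>R z))\<^sup>2)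
          - (?f xstar - s / 2 * (norm xstar)\<^sup>2)"
        by (simp add: \<alpha>(2) xsR)
      also have "\<dots> = ((?f y - s / 2 * (norm y)\<^sup>2) - (?f xstar - s / 2 * (norm xstar)\<^sup>2))
          + \<alpha> * ((A *v y + b - s *\<^sub>R y) \<bullet> z) + \<alpha>\<^sup>2 / 2 * (z \<bullet> (A *v z) - s * (norm z)\<^sup>2)"
        unfolding quad_obj_shifted_expand[OF sym] by simp
      also have "\<dots> \<le> 4 * a / (real t - 1 / 2)\<^sup>2 + 0 + 2 * R\<^sup>2 * \<epsilon>"
      proof (intro add_mono y_gap)
        show "\<alpha> * ((A *v y + b - s *\<^sub>R y) \<bullet> z) \<le> 0" using \<alpha>(1) zdir by (simp add: mult_nonneg_nonpos)
        have "\<alpha>\<^sup>2 / 2 * (z \<bullet> (A *v z) - s * (norm z)\<^sup>2) \<le> \<alpha>\<^sup>2 / 2 * (\<epsilon> * (norm z)\<^sup>2)"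
          using zray by (intro mult_left_mono) auto
        also have "\<dots> = (\<alpha> * norm z)\<^sup>2 / 2 * \<epsilon>" by (simp add: power_mult_distrib)
        also have "\<dots> \<le> (2 * R)\<^sup>2 / 2 * \<epsilon>"
          using \<alpha> \<epsilon>0 by (intro mult_right_mono divide_right_mono power_mono) auto
        finally show "\<alpha>\<^sup>2 / 2 * (z \<bullet> (A *v z) - s * (norm z)\<^sup>2) \<le> 2 * R\<^sup>2 * \<epsilon>"
          by (simp add: power_mult_distrib)
      qed
      \<comment> \<open>The factor 1 / 8 is 2 from the displacement bound \<open>2 * R\<close>,
        divided by the 16 in \<epsilon>.\<close>
      also have "\<dots> = a / (real t - 1 / 2)\<^sup>2 * (4 + 1 / 8 * \<Lambda>)"
        using tpos by (simp add: \<epsilon>_def a_def xsR distrib_left add_divide_distrib mult_ac)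
      finally show ?thesis using True by (simp add: \<Lambda>_def)
    qed
  qed
  show "?f (x t) - ?f xstar \<le> 36 * (?f 0 - ?f xstar)
          * exp (- 4 * real t * sqrt ((lambda_min A + ltr) / (lambda_max A + ltr))) \<and>
    ((lambda_min A < 0 \<longrightarrow> vmin \<bullet> b \<noteq> 0) \<longrightarrow>
     ?f (x t) - ?f xstar
      \<le> (lambda_max A - lambda_min A) * (norm xstar)\<^sup>2 / (real t - 1 / 2)\<^sup>2
          * (4 + of_bool (lambda_min A < 0) / 8
                   * (ln (4 * (norm b)\<^sup>2 / (vmin \<bullet> b)\<^sup>2))\<^sup>2))"
    using first second unfolding E_def a_def l_def h_def by blast
qed

end
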